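(* Let $\{H_n\}$ be a sequence of matrices with each $H_n$ an $n\times n$ Hermitian matrix whose spectrum is contained in $[-1,1]$. Fix real $\mu$, $\beta>0$, let $F_n=\big[I_n+e^{\beta(H_n-\mu I_n)}\big]^{-1}$, and let $\bar\chi$, $c=c(\chi)$, $M(\chi)$ be as follows: $\bar\chi$ is given by $$\bar\chi=\frac{\sqrt{\sqrt{(\beta^2(1-\mu^2)-\pi^2)^2+4\pi^2\beta^2}-\beta^2(1-\mu^2)+\pi^2}}{\sqrt2\,\beta}+\frac{\sqrt{\sqrt{(\beta^2(1-\mu^2)-\pi^2)^2+4\pi^2\beta^2}+\beta^2(1+\mu^2)+\pi^2}}{\sqrt2\,\beta},$$ and $c=2\chi M(\chi)/(\chi-1)$ with $M(\chi)=\max_{z\in\mathcal E_\chi}|1/(1+e^{\beta(z-\mu)})|$. Then for every $1<\chi<\bar\chi$, with $\theta=\ln\chi$, $$|[F_n]_{ij}|\le c\,e^{-\theta\, d_n(i,j)}\quad\text{for all } i\ne j \text{ and all } n.$$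
   Context: For $\chi>1$, $\mathcal E_\chi$ is the ellipse with foci $\pm1$ whose semi-axes sum to $\chi$. $d_n(i,j)$ is the geodetic distance between $i$ and $j$ in the graph $G_n$ associated with $H_n$: vertices $\{1,\dots,n\}$, with an edge between $i\ne j$ iff $[H_n]_{ij}\neq0$; $d_n(i,j)=+\infty$ (and $e^{-\infty}=0$) if $i$ and $j$ are not connected. *)

theory Defs
  imports "HOL-Analysis.Analysis" "HOL-Library.Extended_Nat" "Jordan_Normal_Form.Spectral_Radius"
begin

definition hermitian_mat :: "nat \<Rightarrow> complex mat \<Rightarrow> bool" where
  "hermitian_mat n A \<longleftrightarrow> A \<in> carrier_mat n n \<and>
     (\<forall>i<n. \<forall>j<n. A $$ (i, j) = cnj (A $$ (j, i)))"

definition exp_mat :: "complex mat \<Rightarrow> complex mat" where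
  "exp_mat A = mat (dim_row A) (dim_col A)
     (\<lambda>(i, j). \<Sum>k. (A ^\<^sub>m k) $$ (i, j) / of_nat (fact k))"

definition inv_mat :: "complex mat \<Rightarrow> complex mat" where
  "inv_mat A = (THE B. B \<in> carrier_mat (dim_row A) (dim_row A) \<and>
      A * B = 1\<^sub>m (dim_row A) \<and> B * A = 1\<^sub>m (dim_row A))"

definition fermi_mat :: "real \<Rightarrow> real \<Rightarrow> nat \<Rightarrow> complex mat \<Rightarrow> complex mat" where
  "fermi_mat \<beta> \<mu> n H =
     inv_mat (1\<^sub>m n + exp_mat (complex_of_real \<beta> \<cdot>\<^sub>m (H - complex_of_real \<mu> \<cdot>\<^sub>m 1\<^sub>m n)))"

definition graph_walk :: "nat \<Rightarrow> complex mat \<Rightarrow> nat \<Rightarrow> nat \<Rightarrow> nat \<Rightarrow> bool" where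
  "graph_walk n H k i j \<longleftrightarrow> (\<exists>p :: nat \<Rightarrow> nat. p 0 = i \<and> p k = j \<and> (\<forall>m\<le>k. p m < n) \<and>
      (\<forall>m<k. p m \<noteq> p (Suc m) \<and> H $$ (p m, p (Suc m)) \<noteq> 0))"

definition geo_dist :: "nat \<Rightarrow> complex mat \<Rightarrow> nat \<Rightarrow> nat \<Rightarrow> enat" where
  "geo_dist n H i j = (if \<exists>k. graph_walk n H k i j
       then enat (LEAST k. graph_walk n H k i j) else \<infinity>)"

definition exp_neg_dist :: "real \<Rightarrow> enat \<Rightarrow> real" where
  "exp_neg_dist \<theta> d = (case d of enat k \<Rightarrow> exp (- \<theta> * real k) | \<infinity> \<Rightarrow> 0)"

text \<open>Ellipse E_chi with foci +-1 and semi-axes summing to chi (the curve):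
  semi-major axis a = (chi + 1/chi)/2, so |z-1| + |z+1| = 2a.\<close>
definition bern_ellipse :: "real \<Rightarrow> complex set" where
  "bern_ellipse chi = {z. cmod (z - 1) + cmod (z + 1) = chi + 1 / chi}"

definition M_fd :: "real \<Rightarrow> real \<Rightarrow> real \<Rightarrow> real" where
  "M_fd \<beta> \<mu> chi = (SUP z\<in>bern_ellipse chi. cmod (1 / (1 + exp (complex_of_real \<beta> * (z - complex_of_real \<mu>)))))"

definition c_fd :: "real \<Rightarrow> real \<Rightarrow> real \<Rightarrow> real" where
  "c_fd \<beta> \<mu> chi = 2 * chi * M_fd \<beta> \<mu> chi / (chi - 1)"

definition chi_bar :: "real \<Rightarrow> real \<Rightarrow> real" where
  "chi_bar \<beta> \<mu> =
     sqrt (sqrt ((\<beta>^2 * (1 - \<mu>^2) - pi^2)^2 + 4 * pi^2 * \<beta>^2) - \<beta>^2 * (1 - \<mu>^2) + pi^2)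
       / (sqrt 2 * \<beta>)
   + sqrt (sqrt ((\<beta>^2 * (1 - \<mu>^2) - pi^2)^2 + 4 * pi^2 * \<beta>^2) + \<beta>^2 * (1 + \<mu>^2) + pi^2)
       / (sqrt 2 * \<beta>)"

end

theory Submission
  imports Defs "HOL-Complex_Analysis.Complex_Analysis"
begin

text \<open>
  A polynomial \<open>p\<close> of degree below \<open>d(i,j)\<close> satisfies \<open>[p(H)]\<^sub>i\<^sub>j = 0\<close>, so \<open>[F]\<^sub>i\<^sub>j = [(f - p)(H)]\<^sub>i\<^sub>j\<close>
  for the Fermi function \<open>f\<close>, and since \<open>H\<close> is unitarily diagonalizable this entry is at most
  \<open>sup |f - p|\<close> over \<open>[-1,1]\<close>. Bernstein's theorem bounds the best choice of \<open>p\<close>: under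
  \<open>z = (w + 1/w)/2\<close> the ellipses become circles and \<open>f\<close> becomes a holomorphic function on an annulus
  that is invariant under \<open>w \<mapsto> 1/w\<close>; truncating its Laurent series yields a Chebyshev sum. The number \<open>\<chi>\<close>-bar is
  the sum of the semi-axes of the confocal ellipse through the pole \<open>\<mu> + i\<pi>/\<beta>\<close> nearest to the interval.
\<close>

subsection \<open>Bernstein's approximation theorem\<close>

text \<open>The straight-line homotopy between the two circles moves each point along its ray, so
  the modulus stays between \<open>r\<close> and \<open>s\<close> and the homotopy never leaves the
  annulus.\<close>

lemma Cauchy_annulus_circles:
  assumes "0 < a" "a < r" "r < b" "a < s" "s < b"
    and h: "h holomorphic_on {w::complex. a < cmod w \<and> cmod w < b}"
  shows "contour_integral (circlepath 0 r) h = contour_integral (circlepath 0 s) h"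
proof (rule Cauchy_theorem_homotopic_loops[OF _ _ h])
  let ?S = "{w::complex. a < cmod w \<and> cmod w < b}"
  show "open ?S"
    by (intro open_Collect_conj open_Collect_less continuous_intros)
  show "homotopic_loops ?S (circlepath 0 r) (circlepath 0 s)"
  proof (rule homotopic_loops_linear)
    fix t :: real
    show "closed_segment (circlepath 0 r t) (circlepath 0 s t) \<subseteq> ?S"
    proof
      fix z assume "z \<in> closed_segment (circlepath 0 r t) (circlepath 0 s t)"
      then obtain u where u: "0 \<le> u" "u \<le> 1"
        and z: "z = (1 - u) *\<^sub>R circlepath 0 r t + u *\<^sub>R circlepath 0 s t"
        unfolding closed_segment_def by blast
      define q where "q = (1 - u) * r + u * s"
      have q: "a < q" "q < b"
        using convex_bound_lt[of r b s "1 - u" u] convex_bound_lt[of "-r" "-a" "-s" "1 - u" u] u assms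
        by (auto simp: q_def algebra_simps)
      have "z = of_real q * exp (2 * of_real pi * \<i> * of_real t)"
        unfolding z circlepath q_def by (simp add: scaleR_conv_of_real algebra_simps)
      then have "cmod z = q"
        using q \<open>0 < a\<close> by (simp add: norm_mult)
      then show "z \<in> ?S" using q by simp
    qed
  qed auto
qed auto

text \<open>The difference quotient \<open>G\<close>, completed by the derivative at
  \<open>w0\<close>, is holomorphic on the annulus, so both circles give it the same integral. What
  remains is \<open>g w0\<close> times the integral of \<open>1 / (w - w0)\<close>: this is
  \<open>2 * pi * \<i>\<close> on the outer circle and zero on the inner one, inside which the
  kernel has no pole.\<close>

lemma Cauchy_annulus_formula:
  assumes "0 < a" "a < s" "s < cmod w0" "cmod w0 < r" "r < b"
    and g: "g holomorphic_on {w::complex. a < cmod w \<and> cmod w < b}"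
  shows "contour_integral (circlepath 0 r) (\<lambda>w. g w / (w - w0))
       - contour_integral (circlepath 0 s) (\<lambda>w. g w / (w - w0)) = 2 * pi * \<i> * g w0"
proof -
  let ?S = "{w::complex. a < cmod w \<and> cmod w < b}"
  have opS: "open ?S"
    by (intro open_Collect_conj open_Collect_less continuous_intros)
  define G where "G = (\<lambda>w. if w = w0 then deriv g w0 else (g w - g w0) / (w - w0))"
  have w0: "w0 \<in> ?S" using assms by auto
  have "G holomorphic_on ?S" unfolding G_def
    by (rule pole_lemma_open[OF g opS])
  have sp: "0 < s" "0 < r" using assms by auto
  have "contour_integral (circlepath 0 r) G = contour_integral (circlepath 0 s) G"
    using assms sp by (intro Cauchy_annulus_circles[where a = a and b = b]) (auto simp: \<open>G holomorphic_on ?S\<close>)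
  moreover have *: "contour_integral (circlepath 0 q) G
      = contour_integral (circlepath 0 q) (\<lambda>w. g w / (w - w0))
        - g w0 * contour_integral (circlepath 0 q) (\<lambda>w. 1 / (w - w0))"
    if q: "0 < q" "a < q" "q < b" "q \<noteq> cmod w0" for q
  proof -
    have ne: "w \<noteq> w0" if "w \<in> sphere 0 q" for w using that q by auto
    have con: "continuous_on (sphere 0 q) g"
      by (rule holomorphic_on_imp_continuous_on, rule holomorphic_on_subset[OF g]) (use q in auto)
    have i1: "(\<lambda>w. g w / (w - w0)) contour_integrable_on circlepath 0 q"
      using q by (intro contour_integrable_continuous_circlepath continuous_intros) 
        (auto intro!: continuous_intros continuous_on_subset[OF con])
    have i2: "(\<lambda>w. 1 / (w - w0)) contour_integrable_on circlepath 0 q"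
      using q by (intro contour_integrable_continuous_circlepath continuous_intros) auto
    have "contour_integral (circlepath 0 q) G
      = contour_integral (circlepath 0 q) (\<lambda>w. g w / (w - w0) - g w0 * (1 / (w - w0)))"
      using q by (intro contour_integral_cong) (auto simp: G_def diff_divide_distrib)
    also have "\<dots> = contour_integral (circlepath 0 q) (\<lambda>w. g w / (w - w0))
        - g w0 * contour_integral (circlepath 0 q) (\<lambda>w. 1 / (w - w0))"
      by (simp only: contour_integral_diff[OF i1 contour_integrable_lmul[OF i2]] contour_integral_lmul[OF i2])
    finally show ?thesis .
  qed
  moreover have "contour_integral (circlepath 0 r) (\<lambda>w. 1 / (w - w0)) = 2 * pi * \<i>"
  proof -
    have "((\<lambda>w. 1 / (w - w0)) has_contour_integral 2 * of_real pi * \<i> * 1) (circlepath 0 r)"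
      by (rule Cauchy_integral_circlepath_simple[where f = "\<lambda>_. 1"]) (use assms in auto)
    then show ?thesis by (simp add: contour_integral_unique)
  qed
  moreover have "contour_integral (circlepath 0 s) (\<lambda>w. 1 / (w - w0)) = 0"
  proof -
    have "((\<lambda>w. 1 / (w - w0)) has_contour_integral 0) (circlepath 0 s)"
      by (rule Cauchy_theorem_convex_simple[of _ "ball 0 (cmod w0)"])
         (use assms sp in \<open>auto intro!: holomorphic_intros\<close>)
    then show ?thesis by (simp add: contour_integral_unique)
  qed
  ultimately show ?thesis
    using *[of r] *[of s] assms sp by (simp add: algebra_simps)
qed

text \<open>A finite geometric sum in \<open>w0 / w\<close> with exact remainder, for the circle
  where \<open>w\<close> is larger; its inner counterpart expands in \<open>w / w0\<close>. The
  exact remainders make the truncation error explicit without any infinite series.\<close>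

lemma geometric_kernel_outer:
  fixes w w0 :: complex
  assumes "w \<noteq> 0" "w \<noteq> w0"
  shows "1 / (w - w0) = (\<Sum>k\<le>m. w0 ^ k / w ^ Suc k) + (w0 / w) ^ Suc m / (w - w0)"
proof (induction m)
  case 0
  then show ?case using assms by (simp add: divide_simps)
next
  case (Suc m)
  have "(w0 / w) ^ Suc m / (w - w0)
      = w0 ^ Suc m / w ^ Suc (Suc m) + (w0 / w) ^ Suc (Suc m) / (w - w0)"
    using assms by (simp add: divide_simps power_divide) (simp add: algebra_simps)
  then show ?case using Suc by simp
qed

lemma geometric_kernel_inner:
  fixes w w0 :: complex
  assumes "w0 \<noteq> 0" "w \<noteq> w0"
  shows "1 / (w - w0) = - (\<Sum>k<m. w ^ k / w0 ^ Suc k) + (w / w0) ^ m / (w - w0)"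
proof (induction m)
  case 0
  then show ?case using assms by simp
next
  case (Suc m)
  have "(w / w0) ^ m / (w - w0) = - (w ^ m / w0 ^ Suc m) + (w / w0) ^ Suc m / (w - w0)"
    using assms by (simp add: divide_simps power_divide) (simp add: algebra_simps)
  then show ?case using Suc by simp
qed

text \<open>Serves both circles: \<open>u k * h k w\<close> are the terms of a truncated kernel,
  separated into a factor in \<open>w0\<close> and a factor in \<open>w\<close>. Linearity moves the
  sum out of the integral, and the error is at most the supremum of the integrand times the
  circumference.\<close>

lemma truncated_kernel_bound:
  fixes g :: "complex \<Rightarrow> complex"
  assumes q: "0 < q" and w0: "cmod w0 \<noteq> q"
    and con: "continuous_on (sphere 0 q) g" and h: "\<And>k. k \<in> A \<Longrightarrow> continuous_on (sphere 0 q) (h k)"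
    and "finite A" and "0 \<le> B"
    and B: "\<And>w. cmod w = q \<Longrightarrow> cmod (g w * (1 / (w - w0) - (\<Sum>k\<in>A. u k * h k w))) \<le> B"
  shows "cmod (contour_integral (circlepath 0 q) (\<lambda>w. g w / (w - w0))
      - (\<Sum>k\<in>A. u k * contour_integral (circlepath 0 q) (\<lambda>w. g w * h k w))) \<le> B * (2 * pi * q)"
proof -
  have [simp]: "w \<noteq> w0" if "w \<in> sphere 0 q" for w using that w0 by auto
  have i1: "(\<lambda>w. g w / (w - w0)) contour_integrable_on circlepath 0 q"
    using q con by (intro contour_integrable_continuous_circlepath) (auto intro!: continuous_intros)
  have i2: "(\<lambda>w. g w * h k w) contour_integrable_on circlepath 0 q" if "k \<in> A" for k
    using q con h[OF that] by (intro contour_integrable_continuous_circlepath) (auto intro!: continuous_intros)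
  have "((\<lambda>w. g w / (w - w0) - (\<Sum>k\<in>A. u k * (g w * h k w))) has_contour_integral
     contour_integral (circlepath 0 q) (\<lambda>w. g w / (w - w0))
      - (\<Sum>k\<in>A. u k * contour_integral (circlepath 0 q) (\<lambda>w. g w * h k w))) (circlepath 0 q)"
    by (intro has_contour_integral_diff has_contour_integral_sum has_contour_integral_lmul
        has_contour_integral_integral i1 i2 \<open>finite A\<close>)
  then show ?thesis
    by (rule has_contour_integral_bound_circlepath)
       (use B \<open>0 \<le> B\<close> q in \<open>auto simp: algebra_simps sum_distrib_left\<close>)
qed

text \<open>Cauchy's formula writes \<open>g w0\<close> as a difference of integrals over the radii
  \<open>r\<close> and \<open>1 / r\<close>. Truncating the kernel on the first yields the powers up
  to \<open>m\<close>, on the second the powers from \<open>-m\<close> to \<open>-1\<close>, each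
  with a geometrically small remainder.\<close>

lemma Laurent_truncation:
  assumes r: "1 < r" "r < b"
    and g: "g holomorphic_on {w::complex. 1 / b < cmod w \<and> cmod w < b}"
    and M: "\<And>w. cmod w = r \<or> cmod w = 1 / r \<Longrightarrow> cmod (g w) \<le> M"
  obtains a c :: "nat \<Rightarrow> complex" where
    "\<And>w0. cmod w0 = 1 \<Longrightarrow> cmod (g w0 - ((\<Sum>k\<le>m. a k * w0 ^ k) + (\<Sum>k<m. c k / w0 ^ Suc k)))
       \<le> 2 * M / ((r - 1) * r ^ m)"
proof
  \<comment> \<open>The witnesses are read off the final \<open>show\<close>:
    \<open>I k / (2 * pi * \<i>)\<close> for \<open>a\<close> and
    \<open>J k / (2 * pi * \<i>)\<close> for \<open>c\<close>. Both are defined before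
    \<open>w0\<close> is fixed, so they do not depend on it.\<close>
  define I where "I = (\<lambda>k. contour_integral (circlepath 0 r) (\<lambda>w. g w * (1 / w ^ Suc k)))"
  define J where "J = (\<lambda>k. contour_integral (circlepath 0 (1 / r)) (\<lambda>w. g w * w ^ k))"
  fix w0 :: complex assume w0: "cmod w0 = 1"
  then have [simp]: "w0 \<noteq> 0" by auto
  have "0 \<le> M" using M[of "of_real r"] r by (auto intro: order_trans[OF norm_ge_zero])
  have rb: "1 / b < 1 / r" "1 / r < 1" "1 / b < r" "1 / r < b" using r by (auto simp: divide_simps intro: less_trans[of _ 1] less_1_mult)
  have con: "continuous_on (sphere 0 q) g" if "1 / b < q" "q < b" for q
    by (rule holomorphic_on_imp_continuous_on, rule holomorphic_on_subset[OF g]) (use that in auto)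
  have D: "r - 1 \<le> cmod (w - w0)" if "cmod w = r" for w
    using norm_triangle_ineq2[of w w0] that w0 by simp
  have D': "1 - 1 / r \<le> cmod (w - w0)" if "cmod w = 1 / r" for w
    using norm_triangle_ineq2[of w0 w] that w0 by (simp add: norm_minus_commute)
  define OI where "OI = contour_integral (circlepath 0 r) (\<lambda>w. g w / (w - w0))"
  define OJ where "OJ = contour_integral (circlepath 0 (1 / r)) (\<lambda>w. g w / (w - w0))"
  have "cmod (OI - (\<Sum>k\<in>{..m}. w0 ^ k * I k)) \<le> M * (1 / r ^ Suc m) / (r - 1) * (2 * pi * r)"
    unfolding OI_def I_def
  proof (rule truncated_kernel_bound)
    fix w assume w: "cmod w = r"
    then have w': "w \<noteq> 0" "w \<noteq> w0" using r w0 by auto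
    have "g w * (1 / (w - w0) - (\<Sum>k\<le>m. w0 ^ k * (1 / w ^ Suc k))) = g w * (w0 / w) ^ Suc m / (w - w0)"
      unfolding geometric_kernel_outer[OF w', of m] by simp
    then have "cmod (g w * (1 / (w - w0) - (\<Sum>k\<le>m. w0 ^ k * (1 / w ^ Suc k))))
        = cmod (g w) * (1 / r ^ Suc m) / cmod (w - w0)"
      using w w0 by (simp add: norm_mult norm_divide norm_power power_one_over)
    also have "\<dots> \<le> M * (1 / r ^ Suc m) / (r - 1)"
      using M[of w] D[OF w] w r \<open>0 \<le> M\<close> by (intro frac_le mult_mono) auto
    finally show "cmod (g w * (1 / (w - w0) - (\<Sum>k\<le>m. w0 ^ k * (1 / w ^ Suc k))))
        \<le> M * (1 / r ^ Suc m) / (r - 1)" .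
  qed (use r w0 rb \<open>0 \<le> M\<close> in \<open>auto intro!: con continuous_intros\<close>)
  \<comment> \<open>The outer sum has \<open>m + 1\<close> terms and the inner one \<open>m\<close>;
    after multiplication by the circumferences both errors take this same value.\<close>
  also have "\<dots> = 2 * pi * (M / ((r - 1) * r ^ m))"
    using r by (simp add: field_simps)
  finally have 1: "cmod (OI - (\<Sum>k\<le>m. w0 ^ k * I k)) \<le> 2 * pi * (M / ((r - 1) * r ^ m))" .
  have "cmod (OJ - (\<Sum>k\<in>{..<m}. (- 1 / w0 ^ Suc k) * J k)) \<le> M * (1 / r ^ m) / (1 - 1 / r) * (2 * pi * (1 / r))"
    unfolding OJ_def J_def
  proof (rule truncated_kernel_bound)
    fix w assume w: "cmod w = 1 / r"
    then have w': "w0 \<noteq> 0" "w \<noteq> w0" using r w0 by auto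
    have "g w * (1 / (w - w0) - (\<Sum>k<m. (- 1 / w0 ^ Suc k) * w ^ k)) = g w * (w / w0) ^ m / (w - w0)"
      unfolding geometric_kernel_inner[OF w', of m] by (simp add: sum_negf)
    then have "cmod (g w * (1 / (w - w0) - (\<Sum>k<m. (- 1 / w0 ^ Suc k) * w ^ k)))
        = cmod (g w) * (1 / r ^ m) / cmod (w - w0)"
      using w w0 by (simp add: norm_mult norm_divide norm_power power_one_over)
    also have "\<dots> \<le> M * (1 / r ^ m) / (1 - 1 / r)"
      using M[of w] D'[OF w] w rb r \<open>0 \<le> M\<close> by (intro frac_le mult_mono) auto
    finally show "cmod (g w * (1 / (w - w0) - (\<Sum>k<m. (- 1 / w0 ^ Suc k) * w ^ k)))
        \<le> M * (1 / r ^ m) / (1 - 1 / r)" .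
  qed (use r w0 rb \<open>0 \<le> M\<close> in \<open>auto intro!: con continuous_intros\<close>)
  also have "\<dots> = 2 * pi * (M / ((r - 1) * r ^ m))"
    using r by (simp add: field_simps)
  finally have 2: "cmod (OJ - (\<Sum>k<m. (- 1 / w0 ^ Suc k) * J k)) \<le> 2 * pi * (M / ((r - 1) * r ^ m))" .
  have 3: "OI - OJ = 2 * pi * \<i> * g w0"
    unfolding OI_def OJ_def by (rule Cauchy_annulus_formula[OF _ _ _ _ _ g]) (use r rb w0 in auto)
  let ?A = "\<Sum>k\<le>m. I k / (2 * pi * \<i>) * w0 ^ k"
  let ?C = "\<Sum>k<m. J k / (2 * pi * \<i>) / w0 ^ Suc k"
  have A: "2 * pi * \<i> * ?A = (\<Sum>k\<le>m. w0 ^ k * I k)"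
    unfolding sum_distrib_left by (intro sum.cong) auto
  have C: "2 * pi * \<i> * ?C = - (\<Sum>k<m. (- 1 / w0 ^ Suc k) * J k)"
    unfolding sum_distrib_left sum_negf[symmetric] by (intro sum.cong) auto
  have "2 * pi * cmod (g w0 - (?A + ?C)) = cmod (2 * pi * \<i> * (g w0 - (?A + ?C)))"
    by (simp add: norm_mult)
  also have "2 * pi * \<i> * (g w0 - (?A + ?C))
      = (OI - (\<Sum>k\<le>m. w0 ^ k * I k)) - (OJ - (\<Sum>k<m. (- 1 / w0 ^ Suc k) * J k))"
    unfolding right_diff_distrib distrib_left A C 3[symmetric] by simp
  also have "cmod \<dots> \<le> 2 * pi * (M / ((r - 1) * r ^ m)) + 2 * pi * (M / ((r - 1) * r ^ m))"
    using norm_triangle_ineq4 1 2 by (rule order_trans[OF _ add_mono])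
  also have "\<dots> = 2 * pi * (2 * M / ((r - 1) * r ^ m))" by (simp add: algebra_simps)
  finally show "cmod (g w0 - (?A + ?C)) \<le> 2 * M / ((r - 1) * r ^ m)"
    by (rule mult_left_le_imp_le) simp
qed

section \<open>Chebyshev polynomials and the Joukowski map\<close>

text \<open>The polynomial is twice the \<open>k\<close>-th Chebyshev polynomial, built by the
  three-term recurrence: multiplying by \<open>2 * z = w + 1 / w\<close> raises the exponent by one
  and leaves a lower term to subtract.\<close>

lemma Chebyshev_Joukowski:
  "\<exists>p. degree p \<le> k \<and> (\<forall>w::complex. w \<noteq> 0 \<longrightarrow> poly p ((w + 1 / w) / 2) = w ^ k + 1 / w ^ k)"
proof (induction k rule: induct_nat_012)
  case 0
  show ?case by (intro exI[of _ "[:2:]"]) auto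
next
  case 1
  show ?case by (intro exI[of _ "[:0, 2:]"]) auto
next
  case (ge2 k)
  then obtain p q where p: "degree p \<le> k" "\<And>w::complex. w \<noteq> 0 \<Longrightarrow> poly p ((w + 1 / w) / 2) = w ^ k + 1 / w ^ k"
    and q: "degree q \<le> Suc k" "\<And>w::complex. w \<noteq> 0 \<Longrightarrow> poly q ((w + 1 / w) / 2) = w ^ Suc k + 1 / w ^ Suc k"
    by blast
  have "degree ([:0, 2:] * q - p) \<le> Suc (Suc k)"
    using p(1) q(1) degree_mult_le[of "[:0, 2:]" q] by (intro degree_diff_le) auto
  moreover have "poly ([:0, 2:] * q - p) ((w + 1 / w) / 2) = w ^ Suc (Suc k) + 1 / w ^ Suc (Suc k)"
    if "w \<noteq> 0" for w
  proof -
    have "poly ([:0, 2:] * q - p) ((w + 1 / w) / 2)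
        = (w + 1 / w) * (w ^ Suc k + 1 / w ^ Suc k) - (w ^ k + 1 / w ^ k)"
      unfolding poly_diff poly_mult p(2)[OF that] q(2)[OF that] by simp
    also have "\<dots> = w ^ Suc (Suc k) + 1 / w ^ Suc (Suc k)"
      using that by (simp add: field_simps)
    finally show ?thesis .
  qed
  ultimately show ?case by blast
qed

text \<open>The distances to the foci are the moduli of \<open>(w - 1)\<^sup>2 / (2 * w)\<close> and
  \<open>(w + 1)\<^sup>2 / (2 * w)\<close>, and the parallelogram law adds them up. Hence the
  circles of radius \<open>q\<close> and \<open>1 / q\<close> both land on
  \<open>bern_ellipse q\<close>.\<close>

lemma Joukowski_focal_sum:
  fixes w :: complex
  assumes "w \<noteq> 0"
  shows "cmod ((w + 1 / w) / 2 - 1) + cmod ((w + 1 / w) / 2 + 1) = cmod w + 1 / cmod w"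
proof -
  have "(w + 1 / w) / 2 - 1 = (w - 1)\<^sup>2 / (2 * w)" "(w + 1 / w) / 2 + 1 = (w + 1)\<^sup>2 / (2 * w)"
    using assms by (auto simp: field_simps power2_eq_square)
  moreover have "(cmod (w - 1))\<^sup>2 + (cmod (w + 1))\<^sup>2 = 2 * (cmod w)\<^sup>2 + 2"
    unfolding cmod_power2 by (simp add: power2_eq_square algebra_simps)
  ultimately show ?thesis
    using assms by (simp add: norm_divide norm_power norm_mult add_divide_distrib[symmetric])
      (simp add: divide_simps power2_eq_square)
qed

text \<open>With the focal sum formula this sends the open annulus into the interior of the ellipse
  of parameter \<open>b\<close>; the difference of the two sides factors into positive
  terms.\<close>

lemma add_inverse_less:
  fixes q b :: real
  assumes "1 < b" "1 / b < q" "q < b"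
  shows "q + 1 / q < b + 1 / b"
proof -
  have "0 < q" using assms by (auto intro: less_trans[of 0 "1 / b"])
  have "b + 1 / b - (q + 1 / q) = (b - q) * (q * b - 1) / (q * b)"
    using \<open>0 < q\<close> assms by (simp add: field_simps)
  moreover have "1 < q * b" using assms by (simp add: field_simps)
  ultimately show ?thesis using assms by (smt (verit) divide_pos_pos mult_pos_pos)
qed

theorem Bernstein_approximation:
  assumes r: "1 < r" "r < b"
    and f: "f holomorphic_on {z. cmod (z - 1) + cmod (z + 1) < b + 1 / b}"
    and M: "\<And>z. z \<in> bern_ellipse r \<Longrightarrow> cmod (f z) \<le> M"
  obtains p where "degree p \<le> m"
    "\<And>x. x \<in> {-1..1} \<Longrightarrow> cmod (f (of_real x) - poly p (of_real x)) \<le> 2 * M / ((r - 1) * r ^ m)"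
proof -
  define \<epsilon> where "\<epsilon> = 2 * M / ((r - 1) * r ^ m)"
  define g where "g = (\<lambda>w. f ((w + 1 / w) / 2))"
  have nz: "w \<noteq> 0" if "1 / b < cmod w" for w using that r by auto
  have g_hol: "g holomorphic_on {w. 1 / b < cmod w \<and> cmod w < b}"
    unfolding g_def
    by (rule holomorphic_on_compose_gen[OF _ f, unfolded o_def])
       (use nz r in \<open>auto intro!: holomorphic_intros simp: Joukowski_focal_sum add_inverse_less\<close>)
  \<comment> \<open>Both circles map to the same ellipse, so the single bound \<open>M\<close> on
    \<open>f\<close> covers both integrals.\<close>
  have "cmod (g w) \<le> M" if "cmod w = r \<or> cmod w = 1 / r" for w
  proof -
    have "w \<noteq> 0" using that r by auto
    then show ?thesis
      unfolding g_def using that by (intro M) (auto simp: bern_ellipse_def Joukowski_focal_sum)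
  qed
  from Laurent_truncation[OF r g_hol this, of m] obtain a c where ac:
    "\<And>w0. cmod w0 = 1 \<Longrightarrow> cmod (g w0 - ((\<Sum>k\<le>m. a k * w0 ^ k) + (\<Sum>k<m. c k / w0 ^ Suc k))) \<le> \<epsilon>"
    unfolding \<epsilon>_def by blast
  define L where "L = (\<lambda>w. (\<Sum>k\<le>m. a k * w ^ k) + (\<Sum>k<m. c k / w ^ Suc k))"
  obtain T :: "nat \<Rightarrow> complex poly" where T: "\<And>k. degree (T k) \<le> k"
    "\<And>k w. w \<noteq> 0 \<Longrightarrow> poly (T k) ((w + 1 / w) / 2) = w ^ k + 1 / w ^ k"
    using Chebyshev_Joukowski by metis
  \<comment> \<open>Averaging \<open>w ^ k\<close> with its reciprocal gives half of
    \<open>T k\<close>, hence the halved coefficients. The negative power with coefficient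
    \<open>c k\<close> has exponent \<open>Suc k\<close>, so the highest index that occurs is
    \<open>m\<close>.\<close>
  define p where "p = (\<Sum>k\<le>m. Polynomial.smult (a k / 2) (T k)) + (\<Sum>k<m. Polynomial.smult (c k / 2) (T (Suc k)))"
  have "degree p \<le> m"
    unfolding p_def
    by (intro degree_add_le degree_sum_le) (auto intro: order_trans[OF degree_smult_le] order_trans[OF T(1)])
  moreover have "cmod (f (of_real x) - poly p (of_real x)) \<le> \<epsilon>" if x: "x \<in> {-1..1}" for x
  proof -
    \<comment> \<open>A point \<open>x\<close> of the interval is the cosine of an angle, hence the
      Joukowski image of a point on the unit circle, where the Laurent estimate applies.\<close>
    define w where "w = cis (arccos x)"
    have w: "w \<noteq> 0" "cmod w = 1" "cmod (1 / w) = 1" unfolding w_def by (auto simp: norm_divide)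
    have z: "(w + 1 / w) / 2 = of_real x"
    proof -
      have "1 / w = cis (- arccos x)"
        unfolding w_def using cis_inverse[of "arccos x"] by (simp only: inverse_eq_divide)
      then show ?thesis
        using x unfolding w_def by (simp add: complex_eq_iff cos_arccos)
    qed
    have "poly p (of_real x) = (\<Sum>k\<le>m. a k / 2 * (w ^ k + 1 / w ^ k)) + (\<Sum>k<m. c k / 2 * (w ^ Suc k + 1 / w ^ Suc k))"
      unfolding z[symmetric] p_def by (simp only: poly_add poly_sum poly_smult T(2)[OF w(1)])
    also have "\<dots> = (L w + L (1 / w)) / 2"
    proof -
      have "L w + L (1 / w) = (\<Sum>k\<le>m. a k * (w ^ k + 1 / w ^ k)) + (\<Sum>k<m. c k * (w ^ Suc k + 1 / w ^ Suc k))"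
        unfolding L_def distrib_left sum.distrib by (simp add: power_one_over)
      then show ?thesis
        by (simp only: add_divide_distrib sum_divide_distrib times_divide_eq_left)
    qed
    finally have p: "poly p (of_real x) = (L w + L (1 / w)) / 2" .
    \<comment> \<open>Averaging over \<open>w\<close> and \<open>1/w\<close> makes the truncation symmetric without knowing that the Laurent
      coefficients of \<open>g\<close> are.\<close>
    have "f (of_real x) = (g w + g (1 / w)) / 2"
      unfolding g_def z[symmetric] by (simp add: add.commute)
    then have "f (of_real x) - poly p (of_real x) = ((g w - L w) + (g (1 / w) - L (1 / w))) / 2"
      unfolding p by (simp add: diff_divide_distrib add_divide_distrib)
    also have "cmod \<dots> \<le> (\<epsilon> + \<epsilon>) / 2"
      using norm_triangle_ineq[of "g w - L w" "g (1 / w) - L (1 / w)"] ac[OF w(2)] ac[OF w(3)]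
      unfolding L_def by (simp add: norm_divide)
    finally show ?thesis by simp
  qed
  ultimately show thesis using that unfolding \<epsilon>_def by blast
qed

subsection \<open>Functional calculus for Hermitian matrices\<close>

definition adj :: "complex mat \<Rightarrow> complex mat" where
  "adj A = mat (dim_col A) (dim_row A) (\<lambda>(i, j). cnj (A $$ (j, i)))"

lemma dim_adj [simp]: "dim_row (adj A) = dim_col A" "dim_col (adj A) = dim_row A"
  by (simp_all only: adj_def dim_row_mat dim_col_mat)

lemma index_adj [simp]: "i < dim_col A \<Longrightarrow> j < dim_row A \<Longrightarrow> adj A $$ (i, j) = cnj (A $$ (j, i))"
  unfolding adj_def by (simp only: index_mat split)

lemma adj_carrier [simp]: "A \<in> carrier_mat n m \<Longrightarrow> adj A \<in> carrier_mat m n"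
  by (intro carrier_matI) auto

lemma index_mult_mat_sum:
  assumes "A \<in> carrier_mat n m" "B \<in> carrier_mat m l" "i < n" "j < l"
  shows "(A * B) $$ (i, j) = (\<Sum>k<m. A $$ (i, k) * B $$ (k, j))"
  using assms by (simp add: scalar_prod_def atLeast0LessThan)

lemma adj_mult:
  assumes "A \<in> carrier_mat n m" "B \<in> carrier_mat m l"
  shows "adj (A * B) = adj B * adj A"
proof (rule eq_matI)
  fix i j assume "i < dim_row (adj B * adj A)" "j < dim_col (adj B * adj A)"
  then have ij: "i < l" "j < n" using assms by auto
  have "adj (A * B) $$ (i, j) = (\<Sum>k<m. cnj (A $$ (j, k)) * cnj (B $$ (k, i)))"
    using ij assms index_mult_mat_sum[OF assms ij(2,1)] by simp
  also have "\<dots> = (\<Sum>k<m. adj B $$ (i, k) * adj A $$ (k, j))"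
    using ij assms by (intro sum.cong) auto
  also have "\<dots> = (adj B * adj A) $$ (i, j)"
    using index_mult_mat_sum[OF adj_carrier[OF assms(2)] adj_carrier[OF assms(1)] ij] by simp
  finally show "adj (A * B) $$ (i, j) = (adj B * adj A) $$ (i, j)" .
qed (use assms in auto)

lemma adj_adj [simp]: "adj (adj A) = A"
  by (rule eq_matI) auto

lemma hermitian_mat_iff_adj: "hermitian_mat n A \<longleftrightarrow> A \<in> carrier_mat n n \<and> adj A = A"
proof
  assume h: "hermitian_mat n A"
  then have A: "A \<in> carrier_mat n n" by (simp add: hermitian_mat_def)
  have "adj A = A"
  proof (rule eq_matI)
    fix i j assume "i < dim_row A" "j < dim_col A"
    then have ij: "i < n" "j < n" using A by auto
    then have "A $$ (i, j) = cnj (A $$ (j, i))" using h unfolding hermitian_mat_def by blast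
    moreover have "adj A $$ (i, j) = cnj (A $$ (j, i))" using A ij by (intro index_adj) auto
    ultimately show "adj A $$ (i, j) = A $$ (i, j)" by (rule trans[rotated, OF sym])
  qed (use A in auto)
  with A show "A \<in> carrier_mat n n \<and> adj A = A" ..
next
  assume *: "A \<in> carrier_mat n n \<and> adj A = A"
  have "A $$ (i, j) = cnj (A $$ (j, i))" if "i < n" "j < n" for i j
  proof -
    have "adj A $$ (i, j) = cnj (A $$ (j, i))"
      using * that by (intro index_adj) auto
    then show ?thesis using * by argo
  qed
  with * show "hermitian_mat n A" unfolding hermitian_mat_def by blast
qed

definition unitary_mat :: "nat \<Rightarrow> complex mat \<Rightarrow> bool" where
  "unitary_mat n U \<longleftrightarrow> U \<in> carrier_mat n n \<and> adj U * U = 1\<^sub>m n"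

lemma unitary_matD:
  assumes "unitary_mat n U"
  shows "U \<in> carrier_mat n n" "adj U * U = 1\<^sub>m n" "U * adj U = 1\<^sub>m n"
proof -
  show U: "U \<in> carrier_mat n n" "adj U * U = 1\<^sub>m n"
    using assms by (simp_all add: unitary_mat_def)
  show "U * adj U = 1\<^sub>m n"
    by (rule mat_mult_left_right_inverse[OF adj_carrier[OF U(1)] U])
qed

lemma unitary_mult:
  assumes "unitary_mat n U" "unitary_mat n V"
  shows "unitary_mat n (U * V)"
proof -
  note U = unitary_matD[OF assms(1)] and V = unitary_matD[OF assms(2)]
  have "adj (U * V) * (U * V) = adj V * (adj U * U) * V"
    using U(1) V(1)
    by (simp add: adj_mult[of U n n V n] assoc_mult_mat[of _ n n _ n _ n] mult_carrier_mat[of _ n n _ n])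
  also have "\<dots> = 1\<^sub>m n" using U V by simp
  finally show ?thesis
    using U(1) V(1) by (simp add: unitary_mat_def mult_carrier_mat[of _ n n _ n])
qed

text \<open>Complete \<open>v\<close> to a basis, orthogonalize by Gram-Schmidt and normalize. The
  scalar \<open>a\<close> absorbs the normalization of the first column.\<close>

lemma unitary_completion:
  fixes v :: "complex vec"
  assumes v: "v \<in> carrier_vec n" and v0: "v \<noteq> 0\<^sub>v n"
  obtains U a where "unitary_mat n U" "a \<noteq> 0" "col U 0 = a \<cdot>\<^sub>v v"
proof -
  interpret cof_vec_space n "TYPE(complex)" .
  define b where "b = basis_completion v"
  define ws where "ws = gram_schmidt n b"
  note bc = basis_completion[OF v v0, folded b_def]
  have n: "n \<noteq> 0" 
  proof
    assume "n = 0"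
    with v have "v = 0\<^sub>v n" by (intro eq_vecI) auto
    with v0 show False ..
  qed
  obtain vs where bv: "b = v # vs" using bc(6,7) n by (cases b) auto
  note gs = gram_schmidt_result[OF bc(2) bc(4) bc(5) refl, folded ws_def]
  have len: "length ws = n" using gs(4) bc(6) by simp
  \<comment> \<open>Gram-Schmidt leaves the first vector of the basis unchanged.\<close>
  have "ws ! 0 = v"
    using gram_schmidt_hd[OF v, of vs] len n unfolding bv[symmetric] ws_def[symmetric] by (cases ws) auto
  have ws_dim: "ws ! i \<in> carrier_vec n" if "i < n" for i
    using gs(3) len that nth_mem by blast
  define q where "q = (\<lambda>j. \<Sum>i<n. (cmod (ws ! j $ i))\<^sup>2)"
  have ip: "ws ! k \<bullet>c ws ! j = (\<Sum>i<n. ws ! k $ i * cnj (ws ! j $ i))" if "j < n" "k < n" for j k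
    using ws_dim[OF that(1)] ws_dim[OF that(2)] by (auto simp: scalar_prod_def atLeast0LessThan)
  have ip_q: "ws ! j \<bullet>c ws ! j = of_real (q j)" if "j < n" for j
    unfolding ip[OF that that] q_def by (simp only: of_real_sum complex_norm_square)
  have q: "q j > 0" if "j < n" for j
  proof -
    have "q j \<noteq> 0" using corthogonalD[OF gs(2), of j j] ip_q[OF that] that len by auto
    moreover have "q j \<ge> 0" unfolding q_def by (intro sum_nonneg) auto
    ultimately show ?thesis by simp
  qed
  \<comment> \<open>The Gram-Schmidt vectors are orthogonal but not normalized; \<open>q j\<close>
    is the squared length of the \<open>j\<close>-th one.\<close>
  define U where "U = mat n n (\<lambda>(i, j). ws ! j $ i / of_real (sqrt (q j)))"
  have U: "U \<in> carrier_mat n n" unfolding U_def by simp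
  have "adj U * U = 1\<^sub>m n"
  proof (rule eq_matI)
    fix j k assume "j < dim_row (1\<^sub>m n)" "k < dim_col (1\<^sub>m n)"
    then have jk: "j < n" "k < n" by auto
    have "(adj U * U) $$ (j, k) = (\<Sum>i<n. cnj (U $$ (i, j)) * U $$ (i, k))"
      using U jk by (subst index_mult_mat_sum[OF adj_carrier[OF U] U]) auto
    also have "\<dots> = (\<Sum>i<n. ws ! k $ i * cnj (ws ! j $ i)) / of_real (sqrt (q j) * sqrt (q k))"
      unfolding sum_divide_distrib using jk by (intro sum.cong) (auto simp: U_def)
    also have "\<dots> = (ws ! k \<bullet>c ws ! j) / of_real (sqrt (q j) * sqrt (q k))"
      unfolding ip[OF jk] ..
    also have "\<dots> = (if j = k then 1 else 0)"
    proof (cases "j = k")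
      case True
      then show ?thesis using ip_q[OF jk(1)] q[OF jk(1)] by (simp flip: of_real_mult)
    next
      case False
      then show ?thesis using corthogonalD[OF gs(2), of k j] jk len by auto
    qed
    finally show "(adj U * U) $$ (j, k) = 1\<^sub>m n $$ (j, k)" using jk by simp
  qed (use U in auto)
  then have "unitary_mat n U" using U by (simp add: unitary_mat_def)
  moreover have "col U 0 = (1 / of_real (sqrt (q 0))) \<cdot>\<^sub>v v"
    using v n \<open>ws ! 0 = v\<close> by (intro eq_vecI) (auto simp: U_def)
  moreover have "1 / complex_of_real (sqrt (q 0)) \<noteq> 0" using q[of 0] n by simp
  ultimately show thesis using that by blast
qed

definition diag :: "nat \<Rightarrow> (nat \<Rightarrow> complex) \<Rightarrow> complex mat" where
  "diag n d = mat n n (\<lambda>(i, j). if i = j then d i else 0)"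

lemma diag_carrier [simp]: "diag n d \<in> carrier_mat n n"
  by (simp add: diag_def)

text \<open>Deflation: with an eigenvector as first column of a unitary \<open>W\<close>, the
  conjugated matrix \<open>B\<close> has first column \<open>e\<close> times a unit vector. Being
  Hermitian, it also has a vanishing rest of the first row, and the induction hypothesis
  diagonalizes the remaining block.\<close>

theorem hermitian_diagonalization:
  assumes "hermitian_mat n A"
  shows "\<exists>U d. unitary_mat n U \<and> A = U * diag n d * adj U"
  using assms
proof (induction n arbitrary: A)
  case 0
  then have "A \<in> carrier_mat 0 0" by (simp add: hermitian_mat_def)
  then show ?case
    by (intro exI[of _ "1\<^sub>m 0"]) (auto simp: unitary_mat_def diag_def intro!: eq_matI)
next
  case (Suc m)
  let ?n = "Suc m"
  have A: "A \<in> carrier_mat ?n ?n" and hA: "adj A = A"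
    using Suc.prems by (auto simp: hermitian_mat_iff_adj)
  obtain e v where ev: "v \<in> carrier_vec ?n" "v \<noteq> 0\<^sub>v ?n" "A *\<^sub>v v = e \<cdot>\<^sub>v v"
    using spectrum_non_empty[OF A] A unfolding spectrum_def eigenvalue_def eigenvector_def by auto
  obtain W a where W: "unitary_mat ?n W" and a: "a \<noteq> 0" "col W 0 = a \<cdot>\<^sub>v v"
    using unitary_completion[OF ev(1,2)] by blast
  note W' = unitary_matD[OF W]
  note cs = A W'(1) adj_carrier[OF W'(1)]
  note mc = mult_carrier_mat[of _ ?n ?n _ ?n] and ma = assoc_mult_mat[of _ ?n ?n _ ?n _ ?n]
  define B where "B = adj W * A * W"
  have B: "B \<in> carrier_mat ?n ?n" unfolding B_def using cs by (simp add: mc)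
  have hB: "adj B = B"
    unfolding B_def using cs hA
    by (simp add: adj_mult[of _ ?n ?n _ ?n] mc ma)
  have AB: "A = W * B * adj W"
  proof -
    have "W * B * adj W = (W * adj W) * A * (W * adj W)"
      unfolding B_def using cs by (simp add: mc ma)
    then show ?thesis using A W'(3) by simp
  qed
  have B0: "B $$ (i, 0) = (if i = 0 then e else 0)" if i: "i < ?n" for i
  proof -
    have "A *\<^sub>v col W 0 = e \<cdot>\<^sub>v col W 0"
      unfolding a using A ev by (simp add: mult_mat_vec smult_smult_assoc mult.commute)
    have BA: "B = adj W * (A * W)" unfolding B_def using cs by (simp add: ma)
    have "col B 0 = adj W *\<^sub>v (A *\<^sub>v col W 0)"
      unfolding BA col_mult2[OF cs(3) mult_carrier_mat[OF A W'(1)] zero_less_Suc]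
        col_mult2[OF A W'(1) zero_less_Suc] ..
    also have "\<dots> = e \<cdot>\<^sub>v (adj W *\<^sub>v col W 0)"
      unfolding \<open>A *\<^sub>v col W 0 = e \<cdot>\<^sub>v col W 0\<close> using cs a(2) ev(1)
      by (intro mult_mat_vec[of _ ?n ?n]) auto
    also have "adj W *\<^sub>v col W 0 = col (1\<^sub>m ?n) 0"
      unfolding W'(2)[symmetric] col_mult2[OF cs(3) W'(1) zero_less_Suc] ..
    finally have "col B 0 = e \<cdot>\<^sub>v col (1\<^sub>m ?n) 0" .
    then have "col B 0 $ i = (e \<cdot>\<^sub>v col (1\<^sub>m ?n) 0) $ i" by simp
    then show ?thesis using i B by auto
  qed
  have B0': "B $$ (0, j) = (if j = 0 then cnj e else 0)" if j: "j < ?n" for j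
  proof -
    have "B $$ (0, j) = adj B $$ (0, j)" using hB by simp
    also have "\<dots> = cnj (B $$ (j, 0))" using B j by auto
    finally show ?thesis using B0[OF j] by auto
  qed
  define C where "C = mat m m (\<lambda>(i, j). B $$ (Suc i, Suc j))"
  have C: "C \<in> carrier_mat m m" unfolding C_def by simp
  have "adj C = C"
  proof (rule eq_matI)
    fix i j assume "i < dim_row C" "j < dim_col C"
    then have ij: "i < m" "j < m" using C by auto
    have "adj B $$ (Suc i, Suc j) = B $$ (Suc i, Suc j)" using hB by simp
    then show "adj C $$ (i, j) = C $$ (i, j)" using ij B C by (auto simp: C_def)
  qed (use C in auto)
  then obtain V d where V: "unitary_mat m V" and CV: "C = V * diag m d * adj V"
    using Suc.IH[of C] C by (auto simp: hermitian_mat_iff_adj)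
  note V' = unitary_matD[OF V]
  \<comment> \<open>Block-diagonal matrices with scalar corner \<open>x\<close> multiply blockwise
    and respect adjoints, so the diagonalization of \<open>C\<close> lifts to one of
    \<open>B\<close>.\<close>
  define Q where "Q = (\<lambda>x X. four_block_mat (mat 1 1 (\<lambda>_. x)) (0\<^sub>m 1 m) (0\<^sub>m m 1) X :: complex mat)"
  have Q: "Q x X \<in> carrier_mat ?n ?n" if "X \<in> carrier_mat m m" for x X
    using four_block_carrier_mat[OF mat_carrier[of 1 1 "\<lambda>_. x"] that] by (simp add: Q_def)
  have Q_mult: "Q x X * Q y Y = Q (x * y) (X * Y)" if "X \<in> carrier_mat m m" "Y \<in> carrier_mat m m" for x X y Y
  proof -
    have "mat 1 1 (\<lambda>_. x) * mat 1 1 (\<lambda>_. y) = mat 1 1 (\<lambda>_. x * y)"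
      by (rule eq_matI) (auto simp: scalar_prod_def)
    then show ?thesis
      unfolding Q_def using that by (subst mult_four_block_mat[of _ 1 1 _ m _ m _ _ 1 _ m]) auto
  qed
  have adj_Q: "adj (Q 1 V) = Q 1 (adj V)"
    using V'(1) unfolding Q_def by (intro eq_matI) auto
  have "Q 1 (1\<^sub>m m) = 1\<^sub>m ?n" unfolding Q_def by (intro eq_matI) auto
  then have QV: "unitary_mat ?n (Q 1 V)"
    using V' by (simp add: unitary_mat_def Q adj_Q Q_mult)
  \<comment> \<open>\<open>case_nat e d\<close> puts \<open>e\<close> in front of the eigenvalues
    \<open>d\<close> of the smaller block.\<close>
  have D: "diag ?n (case_nat e d) = Q e (diag m d)"
    unfolding Q_def diag_def by (intro eq_matI) (auto split: nat.split)
  have BQ: "B = Q e C"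
  proof (rule eq_matI)
    fix i j assume "i < dim_row (Q e C)" "j < dim_col (Q e C)"
    then show "B $$ (i, j) = Q e C $$ (i, j)"
      using B0[of i] B0'[of j] C by (cases i; cases j) (auto simp: C_def Q_def)
  qed (use B C in \<open>auto simp: Q_def\<close>)
  have B': "B = Q 1 V * diag ?n (case_nat e d) * adj (Q 1 V)"
    unfolding adj_Q D BQ CV using V'(1) adj_carrier[OF V'(1)]
    by (simp add: Q_mult mult_carrier_mat[of _ m m _ m])
  have "A = (W * Q 1 V) * diag ?n (case_nat e d) * adj (W * Q 1 V)"
    unfolding AB B' using cs Q[OF V'(1), of 1]
    by (simp add: adj_mult[of _ ?n ?n _ ?n] mc ma)
  then show ?case
    using unitary_mult[OF W QV] by blast
qed

text \<open>Matrices diagonal in one fixed unitary basis form a copy of the pointwise algebra of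
  functions on the indices below \<open>n\<close>. If \<open>d\<close> lists the eigenvalues of a
  matrix, then \<open>spec (\<lambda>k. f (d k))\<close> is \<open>f\<close> of that matrix.\<close>

locale spectral =
  fixes n :: nat and U :: "complex mat"
  assumes unitary: "unitary_mat n U"
begin

lemmas U = unitary_matD[OF unitary]

definition spec :: "(nat \<Rightarrow> complex) \<Rightarrow> complex mat" where
  "spec g = U * diag n g * adj U"

lemma spec_carrier [simp]: "spec g \<in> carrier_mat n n"
  unfolding spec_def
  by (intro mult_carrier_mat[of _ n n] adj_carrier diag_carrier U(1))

lemma dim_spec [simp]: "dim_row (spec g) = n" "dim_col (spec g) = n"
  using spec_carrier[of g] by (blast dest: carrier_matD)+

lemma mult_diag_index:
  assumes "i < n" "k < n"
  shows "(U * diag n g) $$ (i, k) = U $$ (i, k) * g k"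
proof -
  have "(U * diag n g) $$ (i, k) = (\<Sum>l<n. U $$ (i, l) * diag n g $$ (l, k))"
    by (rule index_mult_mat_sum[OF U(1) diag_carrier assms])
  also have "\<dots> = (\<Sum>l<n. if l = k then U $$ (i, l) * g l else 0)"
    using assms by (intro sum.cong) (auto simp: diag_def)
  finally show ?thesis using assms by simp
qed

lemma spec_index:
  assumes "i < n" "j < n"
  shows "spec g $$ (i, j) = (\<Sum>k<n. g k * (U $$ (i, k) * cnj (U $$ (j, k))))"
proof -
  have "spec g $$ (i, j) = (\<Sum>k<n. (U * diag n g) $$ (i, k) * adj U $$ (k, j))"
    unfolding spec_def
    by (rule index_mult_mat_sum[OF mult_carrier_mat[OF U(1) diag_carrier] adj_carrier[OF U(1)] assms])
  also have "\<dots> = (\<Sum>k<n. g k * (U $$ (i, k) * cnj (U $$ (j, k))))"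
    using U(1) assms by (intro sum.cong) (auto simp: mult_diag_index)
  finally show ?thesis .
qed

lemma spec_one: "spec (\<lambda>_. 1) = 1\<^sub>m n"
proof -
  have "diag n (\<lambda>_. 1) = 1\<^sub>m n"
    by (rule eq_matI) (auto simp: diag_def)
  then show ?thesis unfolding spec_def using U by simp
qed

lemma spec_add: "spec g + spec h = spec (\<lambda>k. g k + h k)"
  by (rule eq_matI) (auto simp: spec_index algebra_simps sum.distrib)

lemma spec_minus: "spec g - spec h = spec (\<lambda>k. g k - h k)"
  by (rule eq_matI) (auto simp: spec_index algebra_simps sum_subtractf)

lemma spec_smult: "c \<cdot>\<^sub>m spec g = spec (\<lambda>k. c * g k)"
  by (rule eq_matI) (auto simp: spec_index algebra_simps sum_distrib_left)

lemma spec_mult: "spec g * spec h = spec (\<lambda>k. g k * h k)"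
proof -
  note cs = U(1) adj_carrier[OF U(1)]
  have D: "diag n g * diag n h = diag n (\<lambda>k. g k * h k)"
  proof (rule eq_matI)
    fix i j assume "i < dim_row (diag n (\<lambda>k. g k * h k))" "j < dim_col (diag n (\<lambda>k. g k * h k))"
    then have ij: "i < n" "j < n" by (auto simp: diag_def)
    have "(diag n g * diag n h) $$ (i, j) = (\<Sum>k<n. diag n g $$ (i, k) * diag n h $$ (k, j))"
      by (rule index_mult_mat_sum[OF diag_carrier diag_carrier ij])
    also have "\<dots> = (\<Sum>k<n. if k = i then (if i = j then g i * h i else 0) else 0)"
      using ij by (intro sum.cong) (auto simp: diag_def)
    finally show "(diag n g * diag n h) $$ (i, j) = diag n (\<lambda>k. g k * h k) $$ (i, j)"
      using ij by (simp add: diag_def)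
  qed (auto simp: diag_def)
  have "spec g * spec h = U * diag n g * (adj U * U) * diag n h * adj U"
    unfolding spec_def using cs
    by (simp add: assoc_mult_mat[of _ n n _ n _ n] mult_carrier_mat[of _ n n _ n])
  also have "\<dots> = U * diag n g * diag n h * adj U"
    unfolding U(2) right_mult_one_mat[OF mult_carrier_mat[OF U(1) diag_carrier]] ..
  also have "\<dots> = spec (\<lambda>k. g k * h k)"
    unfolding spec_def D[symmetric] using cs
    by (simp add: assoc_mult_mat[of _ n n _ n _ n] mult_carrier_mat[of _ n n _ n])
  finally show ?thesis .
qed

lemma spec_pow: "spec g ^\<^sub>m m = spec (\<lambda>k. g k ^ m)"
  by (induction m) (auto simp: spec_one spec_mult mult.commute)

text \<open>Each entry of the matrix series is a finite linear combination of scalar exponential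
  series, which may be summed separately.\<close>

lemma spec_exp: "exp_mat (spec g) = spec (\<lambda>k. exp (g k))"
proof (rule eq_matI)
  fix i j assume "i < dim_row (spec (\<lambda>k. exp (g k)))" "j < dim_col (spec (\<lambda>k. exp (g k)))"
  then have ij: "i < n" "j < n" by auto
  have "(\<lambda>m. (spec g ^\<^sub>m m) $$ (i, j) / of_nat (fact m)) =
      (\<lambda>m. \<Sum>k<n. (g k ^ m /\<^sub>R fact m) * (U $$ (i, k) * cnj (U $$ (j, k))))"
    using ij by (simp add: fun_eq_iff spec_pow spec_index sum_divide_distrib scaleR_conv_of_real field_simps)
  moreover have "\<dots> sums (\<Sum>k<n. exp (g k) * (U $$ (i, k) * cnj (U $$ (j, k))))"
    by (intro sums_sum sums_mult2 exp_converges)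
  ultimately show "exp_mat (spec g) $$ (i, j) = spec (\<lambda>k. exp (g k)) $$ (i, j)"
    using ij by (simp add: exp_mat_def spec_index sums_iff)
qed (auto simp: exp_mat_def)

lemma spec_inverse:
  assumes "\<And>k. k < n \<Longrightarrow> g k \<noteq> 0"
  shows "inv_mat (spec g) = spec (\<lambda>k. 1 / g k)"
proof -
  have cong: "spec h = spec h'" if "\<And>k. k < n \<Longrightarrow> h k = h' k" for h h'
    using that by (intro eq_matI) (auto simp: spec_index)
  have 1: "spec g * spec (\<lambda>k. 1 / g k) = 1\<^sub>m n" "spec (\<lambda>k. 1 / g k) * spec g = 1\<^sub>m n"
    unfolding spec_mult spec_one[symmetric] using assms by (auto intro!: cong)
  \<comment> \<open>\<open>inv_mat\<close> is a definite description, so uniqueness of the inverse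
    has to be shown as well.\<close>
  have "B = spec (\<lambda>k. 1 / g k)" if B: "B \<in> carrier_mat n n" "B * spec g = 1\<^sub>m n" for B
  proof -
    have "B = B * (spec g * spec (\<lambda>k. 1 / g k))"
      using B 1 by simp
    also have "\<dots> = (B * spec g) * spec (\<lambda>k. 1 / g k)"
      using B by (intro assoc_mult_mat[symmetric, of _ n n _ n _ n]) auto
    finally show ?thesis using B by simp
  qed
  with 1 show ?thesis
    unfolding inv_mat_def by (intro the_equality) auto
qed

lemma spec_fermi:
  assumes "\<And>k. k < n \<Longrightarrow> 1 + exp (complex_of_real \<beta> * (d k - complex_of_real \<mu>)) \<noteq> 0"
  shows "fermi_mat \<beta> \<mu> n (spec d) = spec (\<lambda>k. 1 / (1 + exp (complex_of_real \<beta> * (d k - complex_of_real \<mu>))))"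
  using assms
  by (simp add: fermi_mat_def spec_one[symmetric] spec_smult spec_minus spec_exp spec_add spec_inverse)

lemma spec_poly_index:
  assumes "i < n" "j < n"
  shows "spec (\<lambda>k. poly p (d k)) $$ (i, j) = (\<Sum>m\<le>degree p. coeff p m * (spec d ^\<^sub>m m) $$ (i, j))"
  unfolding spec_pow spec_index[OF assms] poly_altdef sum_distrib_left sum_distrib_right
  by (subst sum.swap) (simp add: mult.assoc)

text \<open>The rows of \<open>U\<close> are unit vectors. Bounding each product of moduli by the
  mean of the squares takes the place of the Cauchy-Schwarz inequality.\<close>

lemma spec_entry_bound:
  assumes "i < n" "j < n" "0 \<le> B" and B: "\<And>k. k < n \<Longrightarrow> cmod (g k) \<le> B"
  shows "cmod (spec g $$ (i, j)) \<le> B"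
proof -
  \<comment> \<open>The squared row lengths are the diagonal entries of \<open>U * adj U\<close>,
    which is \<open>spec (\<lambda>_. 1)\<close>.\<close>
  have row: "(\<Sum>k<n. (cmod (U $$ (i, k)))\<^sup>2) = 1" if "i < n" for i
  proof -
    have "complex_of_real (\<Sum>k<n. (cmod (U $$ (i, k)))\<^sup>2) = spec (\<lambda>_. 1) $$ (i, i)"
      unfolding spec_index[OF that that] of_real_sum complex_norm_square by simp
    then show ?thesis unfolding spec_one using that by (simp add: of_real_eq_1_iff del: of_real_sum)
  qed
  have "cmod (spec g $$ (i, j)) \<le> (\<Sum>k<n. cmod (g k) * (cmod (U $$ (i, k)) * cmod (U $$ (j, k))))"
    unfolding spec_index[OF assms(1,2)] by (rule order_trans[OF norm_sum]) (simp add: norm_mult)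
  also have "\<dots> \<le> (\<Sum>k<n. B * (((cmod (U $$ (i, k)))\<^sup>2 + (cmod (U $$ (j, k)))\<^sup>2) / 2))"
  proof (intro sum_mono mult_mono B)
    fix k
    show "cmod (U $$ (i, k)) * cmod (U $$ (j, k)) \<le> ((cmod (U $$ (i, k)))\<^sup>2 + (cmod (U $$ (j, k)))\<^sup>2) / 2"
      using sum_squares_bound[of "cmod (U $$ (i, k))" "cmod (U $$ (j, k))"] by simp
  qed (use assms in auto)
  also have "\<dots> = B"
    using row[OF assms(1)] row[OF assms(2)]
    by (simp add: sum_distrib_left[symmetric] sum_divide_distrib[symmetric] sum.distrib)
  finally show ?thesis .
qed

text \<open>Column \<open>k\<close> of \<open>U\<close> is an eigenvector for \<open>d k\<close>.
  This is what places the diagonal values in the interval.\<close>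

lemma spec_spectrum:
  assumes "k < n"
  shows "d k \<in> spectrum (spec d)"
proof -
  note cs = U(1) adj_carrier[OF U(1)]
  have "spec d * U = U * diag n d * (adj U * U)"
    unfolding spec_def using cs
    by (simp add: assoc_mult_mat[of _ n n _ n _ n] mult_carrier_mat[of _ n n _ n])
  also have "\<dots> = U * diag n d"
    unfolding U(2) right_mult_one_mat[OF mult_carrier_mat[OF U(1) diag_carrier]] ..
  finally have *: "spec d * U = U * diag n d" .
  have ev: "spec d *\<^sub>v col U k = d k \<cdot>\<^sub>v col U k"
    unfolding col_mult2[OF spec_carrier U(1) assms, symmetric] *
  proof (rule eq_vecI)
    fix i assume "i < dim_vec (d k \<cdot>\<^sub>v col U k)"
    then have i: "i < n" using U(1) by simp
    have "col (U * diag n d) k $ i = (U * diag n d) $$ (i, k)"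
      using i assms U(1) by (intro index_col) (auto simp: diag_def)
    then show "col (U * diag n d) k $ i = (d k \<cdot>\<^sub>v col U k) $ i"
      using i assms U(1) by (simp add: mult_diag_index mult.commute del: index_mult_mat(1))
  qed (use U(1) in auto)
  have "col U k \<noteq> 0\<^sub>v n"
  proof
    assume "col U k = 0\<^sub>v n"
    then have 0: "U $$ (i, k) = 0" if "i < n" for i
      using U(1) assms that index_col[of i U k] by auto
    have "(adj U * U) $$ (k, k) = (\<Sum>i<n. adj U $$ (k, i) * U $$ (i, k))"
      by (rule index_mult_mat_sum[OF cs(2,1) assms assms])
    also have "\<dots> = 0" using 0 by simp
    finally show False using U(2) assms by simp
  qed
  then have "eigenvector (spec d) (col U k) (d k)"
    unfolding eigenvector_def using ev U(1) by (auto simp: carrier_vecI)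
  then show ?thesis unfolding spectrum_def eigenvalue_def by blast
qed

end

section \<open>Matrix powers and walks in the graph\<close>

text \<open>A nonzero entry of a product has a nonzero summand, which prolongs a walk by one edge. A
  diagonal entry of \<open>H\<close> is no edge and leaves the walk as it is, hence a length of at
  most \<open>m\<close> rather than exactly \<open>m\<close>.\<close>

lemma mat_pow_entry_walk:
  assumes H: "H \<in> carrier_mat n n" and "i < n" "j < n" "(H ^\<^sub>m m) $$ (i, j) \<noteq> 0"
  shows "\<exists>k\<le>m. graph_walk n H k i j"
  using assms(3,4)
proof (induction m arbitrary: j)
  case 0
  then have "i = j" using H assms(2) by (auto split: if_splits)
  then show ?case
    using assms(2) by (intro exI[of _ 0]) (auto simp: graph_walk_def intro!: exI[of _ "\<lambda>_. i"])
next
  case (Suc m)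
  have "(H ^\<^sub>m Suc m) $$ (i, j) = (\<Sum>l<n. (H ^\<^sub>m m) $$ (i, l) * H $$ (l, j))"
    using index_mult_mat_sum[OF pow_carrier_mat[OF H] H assms(2) Suc.prems(1)] by simp
  then obtain l where l: "l < n" "(H ^\<^sub>m m) $$ (i, l) \<noteq> 0" "H $$ (l, j) \<noteq> 0"
    using Suc.prems(2) by (metis (no_types, lifting) lessThan_iff mult_eq_0_iff sum.neutral)
  then obtain k where k: "k \<le> m" "graph_walk n H k i l" using Suc.IH by blast
  show ?case
  proof (cases "l = j")
    case True
    then show ?thesis using k le_SucI by blast
  next
    case False
    obtain p where p: "p 0 = i" "p k = l" "\<forall>m\<le>k. p m < n"
      "\<forall>m<k. p m \<noteq> p (Suc m) \<and> H $$ (p m, p (Suc m)) \<noteq> 0"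
      using k(2) unfolding graph_walk_def by blast
    have "graph_walk n H (Suc k) i j"
      unfolding graph_walk_def
      by (rule exI[of _ "p(Suc k := j)"]) (use p False l Suc.prems(1) in \<open>auto simp: less_Suc_eq le_Suc_eq\<close>)
    then show ?thesis using k(1) by (intro exI[of _ "Suc k"]) auto
  qed
qed

lemma mat_pow_entry_geo_dist:
  assumes "H \<in> carrier_mat n n" "i < n" "j < n" "enat m < geo_dist n H i j"
  shows "(H ^\<^sub>m m) $$ (i, j) = 0"
proof (rule ccontr)
  assume "(H ^\<^sub>m m) $$ (i, j) \<noteq> 0"
  then obtain k where k: "k \<le> m" "graph_walk n H k i j"
    using mat_pow_entry_walk[OF assms(1-3)] by blast
  then have "geo_dist n H i j \<le> enat k"
    unfolding geo_dist_def by (auto intro: Least_le)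
  then show False using assms(4) k(1) by (meson enat_ord_simps(1) leD order_trans)
qed

subsection \<open>Poles of the Fermi function\<close>

text \<open>Here \<open>p\<close> is the pole in the upper half plane closest to the real axis. The
  formula for \<open>chi_bar\<close> is the sum of the semi-axes \<open>a\<close> and
  \<open>b\<close> of the ellipse through \<open>p\<close> with foci at 1 and -1.\<close>

lemma chi_bar_focal_sum:
  fixes \<beta> \<mu> :: real
  assumes "\<beta> > 0"
  defines "p \<equiv> Complex \<mu> (pi / \<beta>)"
  shows "chi_bar \<beta> \<mu> > 0" "cmod (p - 1) + cmod (p + 1) = chi_bar \<beta> \<mu> + 1 / chi_bar \<beta> \<mu>"
proof -
  define y where "y = pi / \<beta>"
  have y: "y > 0" "pi = y * \<beta>" using assms by (auto simp: y_def)
  \<comment> \<open>\<open>R\<close> will turn out to be the product of the focal distances of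
    \<open>p\<close>. Then the squared sum of these distances is
    \<open>2 * (\<mu>\<^sup>2 + y\<^sup>2 + 1) + 2 * R\<close>, which is
    \<open>(2 * a)\<^sup>2\<close>.\<close>
  define R where "R = sqrt ((\<mu>\<^sup>2 + y\<^sup>2 - 1)\<^sup>2 + 4 * y\<^sup>2)"
  define a where "a = sqrt ((R + \<mu>\<^sup>2 + y\<^sup>2 + 1) / 2)"
  define b where "b = sqrt ((R + \<mu>\<^sup>2 + y\<^sup>2 - 1) / 2)"
  have R: "\<bar>\<mu>\<^sup>2 + y\<^sup>2 - 1\<bar> \<le> R"
    unfolding R_def by (rule real_le_rsqrt) (simp add: power2_abs)
  have ab: "a\<^sup>2 = (R + \<mu>\<^sup>2 + y\<^sup>2 + 1) / 2" "b\<^sup>2 = (R + \<mu>\<^sup>2 + y\<^sup>2 - 1) / 2" "a > 0" "b \<ge> 0"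
    unfolding a_def b_def using R by (auto simp: abs_le_iff)
  have inner: "sqrt ((\<beta>\<^sup>2 * (1 - \<mu>\<^sup>2) - pi\<^sup>2)\<^sup>2 + 4 * pi\<^sup>2 * \<beta>\<^sup>2) = \<beta>\<^sup>2 * R"
  proof -
    have "(\<beta>\<^sup>2 * (1 - \<mu>\<^sup>2) - pi\<^sup>2)\<^sup>2 + 4 * pi\<^sup>2 * \<beta>\<^sup>2 = (\<beta>\<^sup>2)\<^sup>2 * ((\<mu>\<^sup>2 + y\<^sup>2 - 1)\<^sup>2 + 4 * y\<^sup>2)"
      unfolding y(2) by (simp add: power2_eq_square algebra_simps)
    then show ?thesis unfolding R_def by (simp only: real_sqrt_mult real_sqrt_abs abs_power2)
  qed
  have root: "sqrt (\<beta>\<^sup>2 * u) / (sqrt 2 * \<beta>) = sqrt (u / 2)" for u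
    using assms by (simp add: real_sqrt_mult real_sqrt_divide)
  have "chi_bar \<beta> \<mu> = sqrt (\<beta>\<^sup>2 * (R + \<mu>\<^sup>2 + y\<^sup>2 - 1)) / (sqrt 2 * \<beta>)
      + sqrt (\<beta>\<^sup>2 * (R + \<mu>\<^sup>2 + y\<^sup>2 + 1)) / (sqrt 2 * \<beta>)"
    unfolding chi_bar_def inner unfolding y(2) by (simp add: algebra_simps power_mult_distrib)
  also have "\<dots> = b + a" unfolding root a_def b_def ..
  finally have cb: "chi_bar \<beta> \<mu> = b + a" .
  then show pos: "chi_bar \<beta> \<mu> > 0" using ab by simp
  \<comment> \<open>The relation \<open>a\<^sup>2 - b\<^sup>2 = 1\<close> for these foci makes
    \<open>a - b\<close> the reciprocal of \<open>a + b\<close>, so the focal sum becomes the major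
    axis \<open>2 * a\<close>.\<close>
  have "(a - b) * (b + a) = 1" using ab(1,2) by (simp add: power2_eq_square algebra_simps)
  then have "1 / chi_bar \<beta> \<mu> = a - b" unfolding cb using ab by (simp add: field_simps)
  then have 1: "chi_bar \<beta> \<mu> + 1 / chi_bar \<beta> \<mu> = 2 * a" using cb by simp
  have sq: "(cmod (p - 1))\<^sup>2 = (\<mu> - 1)\<^sup>2 + y\<^sup>2" "(cmod (p + 1))\<^sup>2 = (\<mu> + 1)\<^sup>2 + y\<^sup>2"
    unfolding cmod_power2 p_def by (auto simp: y_def)
  have "cmod (p - 1) * cmod (p + 1) = R"
  proof (rule power2_eq_imp_eq)
    have "(cmod (p - 1) * cmod (p + 1))\<^sup>2 = (\<mu>\<^sup>2 + y\<^sup>2 - 1)\<^sup>2 + 4 * y\<^sup>2"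
      unfolding power_mult_distrib sq by (simp add: power2_eq_square algebra_simps)
    then show "(cmod (p - 1) * cmod (p + 1))\<^sup>2 = R\<^sup>2" unfolding R_def by simp
  qed (use R in auto)
  then have "(cmod (p - 1) + cmod (p + 1))\<^sup>2 = (2 * a)\<^sup>2"
    unfolding power2_sum power_mult_distrib sq ab(1) by (simp add: power2_eq_square algebra_simps)
  then show "cmod (p - 1) + cmod (p + 1) = chi_bar \<beta> \<mu> + 1 / chi_bar \<beta> \<mu>"
    unfolding 1 by (rule power2_eq_imp_eq) (use ab in auto)
qed

text \<open>Every pole has real part \<open>\<mu>\<close> and an imaginary part that is an odd
  multiple of \<open>pi / \<beta>\<close>. Odd integers have modulus at least 1, and for fixed real
  part both focal distances grow with the modulus of the imaginary part.\<close>

lemma fermi_pole_outside: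
  assumes "\<beta> > 0" and 0: "1 + exp (complex_of_real \<beta> * (z - complex_of_real \<mu>)) = 0"
  shows "chi_bar \<beta> \<mu> + 1 / chi_bar \<beta> \<mu> \<le> cmod (z - 1) + cmod (z + 1)"
proof -
  let ?w = "complex_of_real \<beta> * (z - complex_of_real \<mu>)"
  have "exp ?w = exp (of_real pi * \<i>)"
    using 0 by (simp add: add_eq_0_iff)
  then obtain k :: int where k: "?w = of_real pi * \<i> + (of_int (2 * k) * pi) * \<i>"
    unfolding exp_eq by blast
  have "Re ?w = 0" "Im ?w = pi * of_int (2 * k + 1)" unfolding k by (auto simp: algebra_simps)
  then have re: "Re z = \<mu>" and im: "Im z = pi / \<beta> * of_int (2 * k + 1)"
    using \<open>\<beta> > 0\<close> by (auto simp: field_simps)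
  have "1 \<le> \<bar>2 * k + 1\<bar>" by presburger
  then have "(1::real) \<le> \<bar>of_int (2 * k + 1)\<bar>" by linarith
  then have "\<bar>pi / \<beta>\<bar> \<le> \<bar>Im z\<bar>"
    unfolding im abs_mult using \<open>\<beta> > 0\<close> by (metis abs_ge_zero mult.right_neutral mult_left_mono)
  then have "(pi / \<beta>)\<^sup>2 \<le> (Im z)\<^sup>2" by (simp only: abs_le_square_iff)
  then have "cmod (Complex \<mu> (pi / \<beta>) - 1) \<le> cmod (z - 1)" "cmod (Complex \<mu> (pi / \<beta>) + 1) \<le> cmod (z + 1)"
    unfolding cmod_def by (auto simp: re)
  then show ?thesis using chi_bar_focal_sum(2)[OF \<open>\<beta> > 0\<close>, of \<mu>] by linarith
qed

section \<open>The decay bound\<close>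

text \<open>Compactness keeps the supremum in \<open>M_fd\<close> finite, so that it bounds the
  Fermi function on the ellipse. Boundedness comes from
  \<open>2 * z = (z - 1) + (z + 1)\<close>.\<close>

lemma compact_bern_ellipse: "compact (bern_ellipse r)"
proof -
  have "closed (bern_ellipse r)"
    unfolding bern_ellipse_def by (intro closed_Collect_eq continuous_intros)
  moreover have "cmod z \<le> r + 1 / r" if "z \<in> bern_ellipse r" for z
  proof -
    have "2 * cmod z = cmod ((z - 1) + (z + 1))" by (simp add: norm_mult flip: mult_2)
    also have "\<dots> \<le> r + 1 / r"
      using norm_triangle_ineq[of "z - 1" "z + 1"] that by (simp add: bern_ellipse_def)
    finally show ?thesis using norm_ge_zero[of z] by linarith
  qed
  ultimately show ?thesis
    unfolding compact_eq_bounded_closed bounded_iff by blast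
qed

theorem theorem8p2:
  fixes \<beta> \<mu> chi :: real and n :: nat and H :: "complex mat" and i j :: nat
  assumes "\<beta> > 0"
    and "hermitian_mat n H"
    and "spectrum H \<subseteq> complex_of_real ` {-1..1}"
    and "1 < chi" and "chi < chi_bar \<beta> \<mu>"
    and "i < n" and "j < n" and "i \<noteq> j"
  shows "cmod (fermi_mat \<beta> \<mu> n H $$ (i, j))
           \<le> c_fd \<beta> \<mu> chi * exp_neg_dist (ln chi) (geo_dist n H i j)"
proof -
  let ?b = "chi_bar \<beta> \<mu>"
  have chi: "1 < ?b" "1 / ?b < chi"
    using assms(4,5) by (auto intro: less_trans[of _ 1])
  define f where "f = (\<lambda>z. 1 / (1 + exp (complex_of_real \<beta> * (z - complex_of_real \<mu>))))"
  define M where "M = M_fd \<beta> \<mu> chi"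
  define E where "E = (\<lambda>m. 2 * M / ((chi - 1) * chi ^ m))"
  let ?D = "{z. cmod (z - 1) + cmod (z + 1) < ?b + 1 / ?b}"
  have np: "1 + exp (complex_of_real \<beta> * (z - complex_of_real \<mu>)) \<noteq> 0" if "z \<in> ?D" for z
    using fermi_pole_outside[OF \<open>\<beta> > 0\<close>, of z \<mu>] that by auto
  have f: "f holomorphic_on ?D"
    unfolding f_def using np by (intro holomorphic_intros) auto
  have sub: "bern_ellipse chi \<subseteq> ?D"
    using add_inverse_less[OF chi(1,2) assms(5)] by (auto simp: bern_ellipse_def)
  have fM: "cmod (f z) \<le> M" if "z \<in> bern_ellipse chi" for z
  proof -
    have "continuous_on (bern_ellipse chi) (\<lambda>z. cmod (f z))"
      using holomorphic_on_imp_continuous_on[OF holomorphic_on_subset[OF f sub]]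
      by (intro continuous_intros)
    then have "bdd_above ((\<lambda>z. cmod (f z)) ` bern_ellipse chi)"
      by (intro bounded_imp_bdd_above compact_imp_bounded compact_continuous_image compact_bern_ellipse)
    then show ?thesis
      unfolding M_def M_fd_def f_def[symmetric] using that
      by (auto intro!: cSUP_upper simp: f_def)
  qed
  \<comment> \<open>The right vertex of the ellipse shows that it is nonempty, which yields
    \<open>0 \<le> M\<close>.\<close>
  have "complex_of_real ((chi + 1 / chi) / 2) \<in> bern_ellipse chi"
    using Joukowski_focal_sum[of "complex_of_real chi"] \<open>1 < chi\<close> by (simp add: bern_ellipse_def)
  then have M0: "0 \<le> M" using fM norm_ge_zero order_trans by blast
  obtain U d where U: "unitary_mat n U" and H: "H = U * diag n d * adj U"
    using hermitian_diagonalization[OF assms(2)] by blast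
  interpret spectral n U by unfold_locales (rule U)
  have Hd: "H = spec d" unfolding H spec_def ..
  have d: "\<exists>x\<in>{-1..1}. d k = complex_of_real x" if "k < n" for k
    using spec_spectrum[OF that, of d] assms(3) unfolding Hd by auto
  \<comment> \<open>The interval is the degenerate ellipse with focal sum 2, inside all the others
    since \<open>2 \<le> chi + 1 / chi\<close>.\<close>
  have dD: "d k \<in> ?D" if k: "k < n" for k
  proof -
    obtain x where x: "x \<in> {-1..1}" "d k = complex_of_real x" using d[OF k] by blast
    have "cmod (d k - 1) + cmod (d k + 1) = \<bar>x - 1\<bar> + \<bar>x + 1\<bar>"
      unfolding x(2) by (metis norm_of_real of_real_1 of_real_add of_real_diff)
    also have "\<dots> = 2" using x(1) by auto
    also have "2 \<le> chi + 1 / chi"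
      using sum_squares_bound[of chi 1] assms(4) by (simp add: field_simps power2_eq_square)
    also have "\<dots> < ?b + 1 / ?b" by (rule add_inverse_less[OF chi(1,2) assms(5)])
    finally show ?thesis by simp
  qed
  have F: "fermi_mat \<beta> \<mu> n H = spec (\<lambda>k. f (d k))"
    unfolding Hd f_def using np dD by (intro spec_fermi) auto
  \<comment> \<open>All powers occurring in the approximating polynomial have exponent below the
    distance, so its \<open>(i, j)\<close> entry vanishes and only the approximation error is
    left.\<close>
  have key: "cmod (fermi_mat \<beta> \<mu> n H $$ (i, j)) \<le> E m" if m: "enat m < geo_dist n H i j" for m
  proof -
    obtain p where p: "degree p \<le> m"
      "\<And>x. x \<in> {-1..1} \<Longrightarrow> cmod (f (of_real x) - poly p (of_real x)) \<le> E m"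
      using Bernstein_approximation[OF assms(4,5) f fM] unfolding E_def by blast
    have "(H ^\<^sub>m q) $$ (i, j) = 0" if "q \<le> degree p" for q
    proof (rule mat_pow_entry_geo_dist)
      have "enat q \<le> enat m" using that p(1) by simp
      then show "enat q < geo_dist n H i j" using m by (rule le_less_trans)
    qed (use assms Hd in auto)
    then have "spec (\<lambda>k. poly p (d k)) $$ (i, j) = 0"
      unfolding spec_poly_index[OF assms(6,7)] Hd by simp
    then have "fermi_mat \<beta> \<mu> n H $$ (i, j) = (spec (\<lambda>k. f (d k)) - spec (\<lambda>k. poly p (d k))) $$ (i, j)"
      unfolding F using assms(6,7) by simp
    also have "cmod \<dots> \<le> E m"
      unfolding spec_minus
      by (rule spec_entry_bound[OF assms(6,7)]) (use M0 assms(4) p(2) d in \<open>force simp: E_def\<close>)+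
    finally show ?thesis .
  qed
  show ?thesis
  proof (cases "geo_dist n H i j")
    case (enat k)
    \<comment> \<open>Distinct vertices have positive distance \<open>k\<close>, so degree
      \<open>k - 1\<close> is available. The missing degree costs one factor \<open>chi\<close>, the
      one in the numerator of \<open>c_fd\<close>.\<close>
    have "k \<noteq> 0"
    proof
      assume "k = 0"
      then have "\<exists>k. graph_walk n H k i j" "(LEAST k. graph_walk n H k i j) = 0"
        using enat by (auto simp: geo_dist_def split: if_splits)
      then have "graph_walk n H 0 i j" by (metis LeastI_ex)
      then show False using \<open>i \<noteq> j\<close> by (auto simp: graph_walk_def)
    qed
    then obtain m where k: "k = Suc m" by (cases k) auto
    have "cmod (fermi_mat \<beta> \<mu> n H $$ (i, j)) \<le> E m" by (rule key) (simp add: enat k)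
    also have "E m = 2 * chi * M / (chi - 1) * (1 / chi ^ k)"
      unfolding E_def k using assms(4) by (simp add: field_simps)
    also have "1 / chi ^ k = exp (- ln chi * real k)"
    proof -
      have "exp (real k * ln chi) = chi ^ k"
        unfolding exp_of_nat_mult using assms(4) by simp
      then show ?thesis by (simp add: exp_minus mult.commute inverse_eq_divide)
    qed
    finally show ?thesis by (simp add: enat exp_neg_dist_def c_fd_def M_def)
  next
    case infinity
    \<comment> \<open>Without a connecting walk every degree \<open>m\<close> is admissible, and
      letting \<open>m\<close> grow forces the entry to be zero.\<close>
    have "(\<lambda>m. 2 * M / (chi - 1) * (1 / chi) ^ m) \<longlonglongrightarrow> 2 * M / (chi - 1) * 0"
      using assms(4) by (intro tendsto_intros LIMSEQ_realpow_zero) auto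
    moreover have "E = (\<lambda>m. 2 * M / (chi - 1) * (1 / chi) ^ m)"
      unfolding E_def by (simp add: power_one_over)
    ultimately have "E \<longlonglongrightarrow> 0" by simp
    then have "cmod (fermi_mat \<beta> \<mu> n H $$ (i, j)) \<le> 0"
      by (rule LIMSEQ_le_const) (use key infinity in auto)
    then show ?thesis by (simp add: infinity exp_neg_dist_def)
  qed
qed

end
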